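(* (a) For every $\mathbf a\in\mathbb R^N$ with $a_1\le\dots\le a_N$, Algorithm 1a (described in the context) finds the unique solution $\mathbf d$ of the dynamics equations (E). (b) For every $\mathbf d\in\mathbb R^N$ with $d_1\le\dots\le d_N$, Algorithm 1b (described in the context) finds the unique solution $\mathbf a$ of the dynamics equations (E). (c) Each of the two algorithms requires at most $2N$ steps, where a step is one evaluation of the expression $\tilde d_{i,k,h}$ (in Algorithm 1a), respectively $\tilde a_{i,k,h}$ (in Algorithm 1b).
   Context: $N\ge1$ is an integer, $\mathcal N=\{1,\dots,N\}$, and $\alpha,\beta>0$ satisfy $N<\beta/\alpha+1$. The dynamics equations relating the arrival times $\mathbf a=(a_1,\dots,a_N)'$ and departure times $\mathbf d=(d_1,\dots,d_N)'$ (with $a_i\le d_i$) are $$(E)\qquad 1=\int_{a_i}^{d_i}\Big[\beta-\alpha\Big(\sum_{j=1}^N \mathbf 1\{t\in[a_j,d_j]\}-1\Big)\Big]dt,\qquad i\in\mathcal N.$$ Conventions: $a_0=d_0=-\infty$, $a_{N+1}=d_{N+1}=\infty$, empty sums are $0$. For $i,k,h\in\mathcal N$ with $h\le i\le k$ let $$\tilde d_{i,k,h}(\mathbf d\,|\,\mathbf a)=\frac{1+(\beta-\alpha(i-h))a_i+\alpha\big(\sum_{j=h}^{i-1}d_j-\sum_{j=i+1}^{k}a_j\big)}{\beta-\alpha(k-i)},$$ $$\tilde a_{i,k,h}(\mathbf a\,|\,\mathbf d)=\frac{(\beta-\alpha(k-i))d_i-\alpha\big(\sum_{j=h}^{i-1}d_j-\sum_{j=i+1}^{k}a_j\big)-1}{\beta-\alpha(i-h)};$$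 the former only uses $d_h,\dots,d_{i-1}$ from its first argument and the latter only $a_{i+1},\dots,a_k$. Algorithm 1a (input $a_1\le\dots\le a_N$): initialize $k_i=h_i=i$ for all $i$. For $i=1,\dots,N$ in increasing order: set $k=\max(i,k_{i-1})$ (with $k_0:=1$) and compute $\tilde d_{i,k,h_i}(\mathbf d|\mathbf a)$; while $\tilde d_{i,k,h_i}(\mathbf d|\mathbf a)\ge a_{k+1}$, increase $k$ by $1$ and recompute $\tilde d_{i,k,h_i}(\mathbf d|\mathbf a)$; then set $k_i=k$, $d_i=\tilde d_{i,k,h_i}(\mathbf d|\mathbf a)$ (the value last computed), and, if $i<N$, set $h_{i+1}=\min\{h\in\{1,\dots,i+1\}:k_h\ge i+1\}$. Output $\mathbf d,\mathbf k,\mathbf h$. Algorithm 1b (input $d_1\le\dots\le d_N$): initialize $k_i=h_i=i$ for all $i$. For $i=N,\dots,1$ in decreasing order: set $h=\min(i,h_{i+1})$ (with $h_{N+1}:=N$) and compute $\tilde a_{i,k_i,h}(\mathbf a|\mathbf d)$; while $\tilde a_{i,k_i,h}(\mathbf a|\mathbf d)\le d_{h-1}$, decrease $h$ by $1$ and recompute $\tilde a_{i,k_i,h}(\mathbf a|\mathbf d)$; then set $h_i=h$, $a_i=\tilde a_{i,k_i,h}(\mathbf a|\mathbf d)$ (the value last computed), and, if $i>1$, set $k_{i-1}=\max\{k\in\{i-1,\dots,N\}:h_k\le i-1\}$. Output $\mathbf a,\mathbf k,\mathbf h$. *)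

theory Defs
  imports "HOL-Analysis.Analysis" "HOL-Library.While_Combinator"
begin

text \<open>Vectors in $R^N$ are extensional functions on the index set \<open>{1..N}\<close>, so that
  equality of vectors is equality of functions.\<close>

abbreviation vecs :: "nat \<Rightarrow> (nat \<Rightarrow> real) set" where
  "vecs N \<equiv> {1..N} \<rightarrow>\<^sub>E (UNIV :: real set)"

definition dynamics :: "nat \<Rightarrow> real \<Rightarrow> real \<Rightarrow> (nat \<Rightarrow> real) \<Rightarrow> (nat \<Rightarrow> real) \<Rightarrow> bool" where
  "dynamics N \<alpha> \<beta> a d \<longleftrightarrow>
     (\<forall>i\<in>{1..N}. a i \<le> d i \<and>
        ((\<lambda>t. \<beta> - \<alpha> * ((\<Sum>j=1..N. indicat_real {a j..d j} t) - 1)) has_integral 1) {a i..d i})"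

definition with_infinities :: "nat \<Rightarrow> (nat \<Rightarrow> real) \<Rightarrow> nat \<Rightarrow> ereal" where
  "with_infinities N x j = (if j = 0 then -\<infinity> else if j \<le> N then ereal (x j) else \<infinity>)"

definition d_tilde ::
  "real \<Rightarrow> real \<Rightarrow> nat \<Rightarrow> nat \<Rightarrow> nat \<Rightarrow> (nat \<Rightarrow> real) \<Rightarrow> (nat \<Rightarrow> real) \<Rightarrow> real" where
  "d_tilde \<alpha> \<beta> i k h d a =
     (1 + (\<beta> - \<alpha> * (real i - real h)) * a i + \<alpha> * ((\<Sum>j=h..<i. d j) - (\<Sum>j=i+1..k. a j)))
     / (\<beta> - \<alpha> * (real k - real i))"

definition a_tilde ::
  "real \<Rightarrow> real \<Rightarrow> nat \<Rightarrow> nat \<Rightarrow> nat \<Rightarrow> (nat \<Rightarrow> real) \<Rightarrow> (nat \<Rightarrow> real) \<Rightarrow> real" where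
  "a_tilde \<alpha> \<beta> i k h a d =
     ((\<beta> - \<alpha> * (real k - real i)) * d i - \<alpha> * ((\<Sum>j=h..<i. d j) - (\<Sum>j=i+1..k. a j)) - 1)
     / (\<beta> - \<alpha> * (real i - real h))"

text \<open>The field \<open>xvec\<close> holds the vector being computed (departure times in the first
  algorithm, arrival times in the second); its entries are \<open>undefined\<close> until assigned.
  The field \<open>steps\<close> counts the evaluations of \<open>d_tilde\<close> or \<open>a_tilde\<close>.\<close>

record alg_state =
  xvec :: "nat \<Rightarrow> real"
  kvec :: "nat \<Rightarrow> nat"
  hvec :: "nat \<Rightarrow> nat"
  steps :: nat

text \<open>The inner while loops act on triples (current \<open>k\<close> or \<open>h\<close>, value last computed,
  number of evaluations). The result is \<open>None\<close> exactly if some while loop fails to terminate.\<close>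

definition alg1a_body ::
  "nat \<Rightarrow> real \<Rightarrow> real \<Rightarrow> (nat \<Rightarrow> real) \<Rightarrow> nat \<Rightarrow> alg_state \<Rightarrow> alg_state option" where
  "alg1a_body N \<alpha> \<beta> a i s =
     (let dt_k = (\<lambda>k. d_tilde \<alpha> \<beta> i k (hvec s i) (xvec s) a);
          k\<^sub>0 = max i (kvec s (i - 1))
      in map_option
           (\<lambda>(k, v, c).
             let kv = (kvec s)(i := k) in
             \<lparr> xvec = (xvec s)(i := v),
               kvec = kv,
               hvec = (if i < N
                       then (hvec s)(i + 1 := Min {h \<in> {1..i+1}. i + 1 \<le> kv h})
                       else hvec s),
               steps = c \<rparr>)
           (while_option
             (\<lambda>(k, v, c). ereal v \<ge> with_infinities N a (k + 1))
             (\<lambda>(k, v, c). (k + 1, dt_k (k + 1), c + 1))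
             (k\<^sub>0, dt_k k\<^sub>0, steps s + 1)))"

definition alg1a :: "nat \<Rightarrow> real \<Rightarrow> real \<Rightarrow> (nat \<Rightarrow> real) \<Rightarrow> alg_state option" where
  "alg1a N \<alpha> \<beta> a =
     fold (\<lambda>i s. Option.bind s (alg1a_body N \<alpha> \<beta> a i)) [1..<N+1]
       (Some \<lparr> xvec = (\<lambda>_. undefined), kvec = (\<lambda>i. i)(0 := 1), hvec = (\<lambda>i. i), steps = 0 \<rparr>)"

definition alg1b_body ::
  "nat \<Rightarrow> real \<Rightarrow> real \<Rightarrow> (nat \<Rightarrow> real) \<Rightarrow> nat \<Rightarrow> alg_state \<Rightarrow> alg_state option" where
  "alg1b_body N \<alpha> \<beta> d i s =
     (let at_h = (\<lambda>h. a_tilde \<alpha> \<beta> i (kvec s i) h (xvec s) d);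
          h\<^sub>0 = min i (hvec s (i + 1))
      in map_option
           (\<lambda>(h, v, c).
             let hv = (hvec s)(i := h) in
             \<lparr> xvec = (xvec s)(i := v),
               kvec = (if i > 1
                       then (kvec s)(i - 1 := Max {k \<in> {i-1..N}. hv k \<le> i - 1})
                       else kvec s),
               hvec = hv,
               steps = c \<rparr>)
           (while_option
             (\<lambda>(h, v, c). ereal v \<le> with_infinities N d (h - 1))
             (\<lambda>(h, v, c). (h - 1, at_h (h - 1), c + 1))
             (h\<^sub>0, at_h h\<^sub>0, steps s + 1)))"

definition alg1b :: "nat \<Rightarrow> real \<Rightarrow> real \<Rightarrow> (nat \<Rightarrow> real) \<Rightarrow> alg_state option" where
  "alg1b N \<alpha> \<beta> d =
     fold (\<lambda>i s. Option.bind s (alg1b_body N \<alpha> \<beta> d i)) (rev [1..<N+1])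
       (Some \<lparr> xvec = (\<lambda>_. undefined), kvec = (\<lambda>i. i), hvec = (\<lambda>i. i)(N + 1 := N), steps = 0 \<rparr>)"

end

theory Submission
  imports Defs
begin

text \<open>Since the service rate stays positive, no interval of a solution is strictly nested in
  another one, so arrival and departure times are ordered alike. User \<open>i\<close> then
  shares the server only with earlier users still present at \<open>a\<^sub>i\<close> and with later users arriving
  before \<open>d\<^sub>i\<close>, so that \<open>d\<^sub>i\<close> is the point where a strictly increasing, piecewise affine function of
  \<open>a\<close> and \<open>d\<^sub>1, \<dots>, d\<^bsub>i-1\<^esub>\<close> reaches 1. This yields uniqueness, and the inner loop of the first
  algorithm is a search for the affine piece containing that point, which never moves back
  from one user to the next. Time reversal \<open>t \<mapsto> -t\<close> together with \<open>i \<mapsto> N + 1 - i\<close>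
  exchanges arrivals and departures and turns the second algorithm into the first.\<close>

section \<open>The dynamics equations in terms of interval overlaps\<close>

definition overlap :: "(nat \<Rightarrow> real) \<Rightarrow> (nat \<Rightarrow> real) \<Rightarrow> nat \<Rightarrow> nat \<Rightarrow> real" where
  "overlap a d i j = max 0 (min (d i) (d j) - max (a i) (a j))"

lemma has_integral_indicat_real_interval:
  fixes a b c d :: real
  shows "(indicat_real {c..d} has_integral max 0 (min b d - max a c)) {a..b}"
proof -
  have "((\<lambda>x. 1::real) has_integral max 0 (min b d - max a c)) {max a c..min b d}"
    by (cases "max a c \<le> min b d")
      (use has_integral_const_real[of "1::real" "max a c" "min b d"] in \<open>auto simp: max_def\<close>)
  then have "((\<lambda>x. if x \<in> {c..d} then 1::real else 0) has_integral max 0 (min b d - max a c)) {a..b}"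
    by (simp only: has_integral_restrict_Int) (simp add: Int_commute)
  moreover have "indicat_real {c..d} = (\<lambda>x. if x \<in> {c..d} then 1 else 0)"
    by (simp add: fun_eq_iff indicator_def)
  ultimately show ?thesis
    by simp
qed

text \<open>The sum counts user \<open>i\<close> itself, so the rate is \<beta> + \<alpha> minus
  \<alpha> per user present. Integration turns each indicator into an overlap, and uniqueness of
  integrals makes (E) purely algebraic.\<close>

lemma dynamics_iff_overlap:
  "dynamics N \<alpha> \<beta> a d \<longleftrightarrow>
     (\<forall>i\<in>{1..N}. a i \<le> d i \<and>
        (\<beta> + \<alpha>) * (d i - a i) - \<alpha> * (\<Sum>j=1..N. overlap a d i j) = 1)"
proof -
  have *: "((\<lambda>t. \<beta> - \<alpha> * ((\<Sum>j=1..N. indicat_real {a j..d j} t) - 1)) has_integral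
      (\<beta> + \<alpha>) * (d i - a i) - \<alpha> * (\<Sum>j=1..N. overlap a d i j)) {a i..d i}"
    if "a i \<le> d i" for i
  proof -
    have "((\<lambda>t. (\<beta> + \<alpha>) - \<alpha> * (\<Sum>j=1..N. indicat_real {a j..d j} t)) has_integral
      (d i - a i) *\<^sub>R (\<beta> + \<alpha>) - \<alpha> * (\<Sum>j=1..N. overlap a d i j)) {a i..d i}"
      using that has_integral_const_real[of "\<beta> + \<alpha>" "a i" "d i"] unfolding overlap_def
      by (intro has_integral_diff has_integral_mult_right has_integral_sum
            has_integral_indicat_real_interval) auto
    then show ?thesis
      by (simp add: algebra_simps)
  qed
  show ?thesis
    unfolding dynamics_def using * has_integral_unique by (metis (no_types, lifting))
qed

text \<open>Passing from the inner to the outer interval adds a set whose total length is the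
  right-hand side, and no interval can overlap it by more.\<close>

lemma overlap_diff_le:
  assumes "a i \<le> a j" "a j \<le> d j" "d j \<le> d i"
  shows "overlap a d i l - overlap a d j l \<le> (d i - a i) - (d j - a j)"
  using assms unfolding overlap_def by (auto simp: max_def min_def)

section \<open>Time reversal\<close>

text \<open>Flipping the indices restores the increasing order that negation reverses. The
  restriction to \<open>{1..N}\<close> lands in \<open>vecs N\<close>, on which the map is an
  involution.\<close>

definition reflect :: "nat \<Rightarrow> (nat \<Rightarrow> real) \<Rightarrow> nat \<Rightarrow> real" where
  "reflect N x = (\<lambda>i\<in>{1..N}. - x (N + 1 - i))"

lemma reflect_in_vecs: "reflect N x \<in> vecs N"
  by (simp add: reflect_def)

lemma reflect_apply: "i \<in> {1..N} \<Longrightarrow> reflect N x i = - x (N + 1 - i)"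
  by (simp add: reflect_def)

lemma reflect_reflect:
  assumes "x \<in> vecs N"
  shows "reflect N (reflect N x) = x"
  using assms by (auto simp: reflect_def fun_eq_iff PiE_def extensional_def)

lemma mono_on_reflect:
  assumes "mono_on {1..N} x"
  shows "mono_on {1..N} (reflect N x)"
  by (intro mono_onI) (auto simp: reflect_apply intro!: mono_onD[OF assms])

lemma overlap_reflect:
  assumes "i \<in> {1..N}" "j \<in> {1..N}"
  shows "overlap (reflect N d) (reflect N a) i j = overlap a d (N + 1 - i) (N + 1 - j)"
  using assms by (auto simp: overlap_def reflect_apply max_def min_def)

lemma sum_reflect_interval:
  fixes f :: "nat \<Rightarrow> real"
  assumes "m \<le> N" "1 \<le> l"
  shows "(\<Sum>j=N + 1 - m..N + 1 - l. f j) = (\<Sum>j=l..m. f (N + 1 - j))"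
  by (rule sum.reindex_bij_witness[of _ "\<lambda>j. N + 1 - j" "\<lambda>j. N + 1 - j"]) (use assms in auto)

text \<open>The interval from \<open>a j\<close> to \<open>d j\<close> becomes the one from
  \<open>- d j\<close> to \<open>- a j\<close>, so lengths and overlaps survive and only the order
  of summation changes.\<close>

lemma dynamics_reflect:
  assumes "dynamics N \<alpha> \<beta> a d"
  shows "dynamics N \<alpha> \<beta> (reflect N d) (reflect N a)"
  unfolding dynamics_iff_overlap
proof (intro ballI)
  fix i assume i: "i \<in> {1..N}"
  let ?i = "N + 1 - i"
  have i': "?i \<in> {1..N}" using i by auto
  have "(\<Sum>j=1..N. overlap (reflect N d) (reflect N a) i j)
      = (\<Sum>j=1..N. overlap a d ?i (N + 1 - j))"
    using i by (intro sum.cong) (auto simp: overlap_reflect)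
  also have "\<dots> = (\<Sum>j=1..N. overlap a d ?i j)"
    using sum_reflect_interval[of N N 1 "overlap a d ?i"] by simp
  finally show "reflect N d i \<le> reflect N a i \<and>
        (\<beta> + \<alpha>) * (reflect N a i - reflect N d i)
        - \<alpha> * (\<Sum>j=1..N. overlap (reflect N d) (reflect N a) i j) = 1"
    using assms i i' unfolding dynamics_iff_overlap by (auto simp: reflect_apply)
qed

section \<open>Sorted departures and reduction to served amounts\<close>

locale queue =
  fixes N :: nat and \<alpha> \<beta> :: real
  assumes N_pos: "1 \<le> N" and alpha_pos: "0 < \<alpha>" and rate_pos: "\<alpha> * (real N - 1) < \<beta>"
begin

lemma rate_at_pos:
  assumes "x \<le> real N - 1"
  shows "0 < \<beta> - \<alpha> * x"
  using mult_left_mono[OF assms, of \<alpha>] alpha_pos rate_pos by linarith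

text \<open>Of two nested intervals, the inner one would receive strictly less service.\<close>

lemma dynamics_not_nested:
  assumes dyn: "dynamics N \<alpha> \<beta> a d" and ij: "i \<in> {1..N}" "j \<in> {1..N}"
    and nested: "a i \<le> a j" "d j \<le> d i"
  shows "a i = a j \<and> d i = d j"
proof -
  define D where "D = (d i - a i) - (d j - a j)"
  have "a j \<le> d j" using dyn ij by (auto simp: dynamics_iff_overlap)
  then have "(\<Sum>l=1..N. overlap a d i l - overlap a d j l) \<le> (\<Sum>l=1..N. D)"
    unfolding D_def using nested by (intro sum_mono overlap_diff_le) auto
  then have "\<alpha> * ((\<Sum>l=1..N. overlap a d i l) - (\<Sum>l=1..N. overlap a d j l)) \<le> \<alpha> * (N * D)"
    using alpha_pos by (intro mult_left_mono) (simp_all add: sum_subtractf)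
  moreover have "(\<beta> + \<alpha>) * (d i - a i) - \<alpha> * (\<Sum>l=1..N. overlap a d i l) =
      (\<beta> + \<alpha>) * (d j - a j) - \<alpha> * (\<Sum>l=1..N. overlap a d j l)"
    using dyn ij by (simp add: dynamics_iff_overlap)
  \<comment> \<open>Both users receive service 1, so (\<beta> + \<alpha>) D equals \<alpha> times
    the difference of the overlap sums, which is at most \<alpha> N D.\<close>
  ultimately have "(\<beta> - \<alpha> * (real N - 1)) * D \<le> 0"
    unfolding D_def by (simp add: algebra_simps)
  then have "D \<le> 0"
    using rate_pos by (simp add: mult_le_0_iff)
  then show ?thesis using nested unfolding D_def by linarith
qed

text \<open>An inversion would nest the interval of the later arrival strictly in the other. Hence
  uniqueness can be proved against arbitrary solutions, sorted or not.\<close>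

lemma dynamics_mono:
  assumes dyn: "dynamics N \<alpha> \<beta> a d" and a: "mono_on {1..N} a"
  shows "mono_on {1..N} d"
proof (intro mono_onI)
  fix i j assume ij: "i \<in> {1..N}" "j \<in> {1..N}" "i \<le> j"
  then have "a i \<le> a j" using mono_onD[OF a] by blast
  then show "d i \<le> d j" using dynamics_not_nested[OF dyn ij(1,2)] by force
qed

text \<open>For sorted vectors this is the amount of service received by user \<open>i\<close> up to time \<open>x\<close>,
  provided that the users before \<open>i\<close> have left by then.\<close>

definition served :: "(nat \<Rightarrow> real) \<Rightarrow> (nat \<Rightarrow> real) \<Rightarrow> nat \<Rightarrow> real \<Rightarrow> real" where
  "served a d i x = \<beta> * (x - a i)
     - \<alpha> * ((\<Sum>j=1..<i. max 0 (d j - a i)) + (\<Sum>j=i+1..N. max 0 (x - a j)))"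

text \<open>Only earlier departures enter, so the system for the departure times is triangular and
  can be solved user by user.\<close>

lemma served_cong: "(\<And>j. j \<in> {1..<i} \<Longrightarrow> d j = d' j) \<Longrightarrow> served a d i x = served a d' i x"
  by (simp add: served_def)

text \<open>For sorted vectors a nonempty overlap of \<open>i\<close> with an earlier
  \<open>j\<close> runs from \<open>a i\<close> to \<open>d j\<close>, with a later \<open>j\<close>
  from \<open>a j\<close> to \<open>d i\<close>; the overlap of \<open>i\<close> with itself cancels
  the extra \<alpha>.\<close>

lemma dynamics_iff_served:
  assumes a: "mono_on {1..N} a" and d: "mono_on {1..N} d"
  shows "dynamics N \<alpha> \<beta> a d \<longleftrightarrow> (\<forall>i\<in>{1..N}. a i \<le> d i \<and> served a d i (d i) = 1)"
proof -
  have "(\<beta> + \<alpha>) * (d i - a i) - \<alpha> * (\<Sum>j=1..N. overlap a d i j) = served a d i (d i)"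
    if i: "i \<in> {1..N}" and le: "a i \<le> d i" for i
  proof -
    have "{1..N} = {1..<i} \<union> {i} \<union> {i+1..N}" "{1..<i} \<inter> {i+1..N} = {}"
      using i by auto
    then have "(\<Sum>j=1..N. overlap a d i j) =
        (\<Sum>j=1..<i. overlap a d i j) + overlap a d i i + (\<Sum>j=i+1..N. overlap a d i j)"
      by (simp add: sum.union_disjoint)
    also have "(\<Sum>j=1..<i. overlap a d i j) = (\<Sum>j=1..<i. max 0 (d j - a i))"
      using i mono_onD[OF a, of _ i] mono_onD[OF d, of _ i]
      by (intro sum.cong) (auto simp: overlap_def)
    also have "(\<Sum>j=i+1..N. overlap a d i j) = (\<Sum>j=i+1..N. max 0 (d i - a j))"
      using i mono_onD[OF a, of i] mono_onD[OF d, of i]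
      by (intro sum.cong) (auto simp: overlap_def)
    also have "overlap a d i i = d i - a i"
      using le by (simp add: overlap_def)
    finally have "(\<Sum>j=1..N. overlap a d i j) = (\<Sum>j=1..<i. max 0 (d j - a i)) + (d i - a i)
        + (\<Sum>j=i+1..N. max 0 (d i - a j))" .
    then show ?thesis
      unfolding served_def by (simp only:) (simp add: algebra_simps)
  qed
  then show ?thesis unfolding dynamics_iff_overlap by auto
qed

section \<open>Monotonicity of the served amount and uniqueness of departures\<close>

text \<open>Each of the \<open>N - i\<close> later users lowers the slope \<beta> by at most
  \<alpha>, which leaves it positive.\<close>

lemma served_less:
  assumes i: "i \<in> {1..N}" and "x < y"
  shows "served a d i x < served a d i y"
proof -
  have "(\<Sum>j=i+1..N. max 0 (y - a j)) \<le> (\<Sum>j=i+1..N. max 0 (x - a j) + (y - x))"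
    using \<open>x < y\<close> by (intro sum_mono) auto
  also have "\<dots> = (\<Sum>j=i+1..N. max 0 (x - a j)) + (real N - real i) * (y - x)"
    using i by (simp add: sum.distrib)
  finally have "\<alpha> * (\<Sum>j=i+1..N. max 0 (y - a j))
      \<le> \<alpha> * ((\<Sum>j=i+1..N. max 0 (x - a j)) + (real N - real i) * (y - x))"
    using alpha_pos by simp
  moreover have "0 < (\<beta> - \<alpha> * (real N - real i)) * (y - x)"
    using i \<open>x < y\<close> rate_at_pos[of "real N - real i"] by simp
  ultimately show ?thesis by (simp add: served_def algebra_simps)
qed

lemma served_less_iff:
  assumes i: "i \<in> {1..N}"
  shows "served a d i x < served a d i y \<longleftrightarrow> x < y"
  using served_less[OF i] by (metis less_asym' linorder_neqE)

lemma served_at_arrival: "served a d i (a i) \<le> 0"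
  using alpha_pos unfolding served_def by (auto intro!: mult_nonneg_nonneg add_nonneg_nonneg sum_nonneg)

text \<open>The mutual overlap of the two users occurs in both values and cancels. Arriving later by
  \<open>e\<close> costs \<beta> e and saves at most \<alpha> (i - 1) e on earlier users. So if
  \<open>i\<close> finishes at \<open>d i\<close>, user \<open>i + 1\<close> does not finish
  earlier, which lets the search resume from the previous \<open>k\<close>.\<close>

lemma served_Suc_le:
  assumes a: "mono_on {1..N} a" and i: "1 \<le> i" "i < N" and "a i \<le> d i"
  shows "served a d (Suc i) (d i) \<le> served a d i (d i)"
proof -
  define e where "e = a (Suc i) - a i"
  have e: "0 \<le> e" using i mono_onD[OF a, of i "Suc i"] by (simp add: e_def)
  have "(\<Sum>j=1..<i. max 0 (d j - a i)) \<le> (\<Sum>j=1..<i. max 0 (d j - a (Suc i)) + e)"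
    using e by (intro sum_mono) (auto simp: e_def)
  also have "\<dots> = (\<Sum>j=1..<i. max 0 (d j - a (Suc i))) + (real i - 1) * e"
    using i by (simp add: sum.distrib)
  finally have "\<alpha> * (\<Sum>j=1..<i. max 0 (d j - a i))
      \<le> \<alpha> * ((\<Sum>j=1..<i. max 0 (d j - a (Suc i))) + (real i - 1) * e)"
    using alpha_pos by simp
  moreover have "0 \<le> (\<beta> - \<alpha> * (real i - 1)) * e"
    using e i rate_at_pos[of "real i - 1"] by simp
  moreover have "(\<Sum>j=1..<Suc i. max 0 (d j - a (Suc i))) =
      (\<Sum>j=1..<i. max 0 (d j - a (Suc i))) + max 0 (d i - a (Suc i))"
    using i by simp
  moreover have "(\<Sum>j=i+1..N. max 0 (d i - a j)) =
      max 0 (d i - a (Suc i)) + (\<Sum>j=Suc i+1..N. max 0 (d i - a j))"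
    using i by (simp add: sum.atLeast_Suc_atMost)
  ultimately show ?thesis by (simp add: served_def e_def algebra_simps)
qed

text \<open>Strong induction: once all predecessors agree, both entries are points where the same
  strictly increasing function equals 1.\<close>

lemma dynamics_unique:
  assumes a: "mono_on {1..N} a" and d: "d \<in> vecs N" "dynamics N \<alpha> \<beta> a d"
    and d': "d' \<in> vecs N" "dynamics N \<alpha> \<beta> a d'"
  shows "d = d'"
proof (rule PiE_ext[OF d(1) d'(1)])
  fix i assume "i \<in> {1..N}"
  then show "d i = d' i"
  proof (induction i rule: less_induct)
    case (less i)
    have "served a d i x = served a d' i x" for x
      using less by (intro served_cong) auto
    moreover have "served a d i (d i) = 1" "served a d' i (d' i) = 1"
      using less.prems d d' dynamics_iff_served[OF a] dynamics_mono a by blast+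
    ultimately show ?case
      using served_less_iff[OF less.prems, of a d] by (metis less_irrefl linorder_neqE)
  qed
qed

text \<open>Between consecutive arrivals the served amount is affine and \<open>d_tilde\<close> is the point
  where its affine extension reaches 1.\<close>

lemma served_affine:
  assumes a: "mono_on {1..N} a" and i: "1 \<le> h" "h \<le> i" "i \<le> k" "k \<le> N"
    and h: "\<And>j. j \<in> {1..<i} \<Longrightarrow> h \<le> j \<longleftrightarrow> a i \<le> d j"
    and k: "i < k \<Longrightarrow> a k \<le> x" "k < N \<Longrightarrow> x \<le> a (k + 1)"
  shows "served a d i x =
    1 + (\<beta> - \<alpha> * (real k - real i)) * (x - d_tilde \<alpha> \<beta> i k h d a)"
proof -
  have "{1..<i} = {1..<h} \<union> {h..<i}" using i by auto
  then have "(\<Sum>j=1..<i. max 0 (d j - a i)) =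
      (\<Sum>j=1..<h. max 0 (d j - a i)) + (\<Sum>j=h..<i. max 0 (d j - a i))"
    by (simp add: sum.union_disjoint)
  \<comment> \<open>By assumption \<open>h\<close>, users before \<open>h\<close> have left before
    \<open>a i\<close>, while those from \<open>h\<close> on are still present then.\<close>
  also have "(\<Sum>j=1..<h. max 0 (d j - a i)) = 0"
    using i h by (intro sum.neutral) force
  also have "(\<Sum>j=h..<i. max 0 (d j - a i)) = (\<Sum>j=h..<i. d j - a i)"
  proof (intro sum.cong refl)
    fix j assume "j \<in> {h..<i}"
    then have "a i \<le> d j" using i h[of j] by auto
    then show "max 0 (d j - a i) = d j - a i" by simp
  qed
  also have "\<dots> = (\<Sum>j=h..<i. d j) - (real i - real h) * a i"
    using i by (simp add: sum_subtractf)
  finally have d_sum: "(\<Sum>j=1..<i. max 0 (d j - a i)) = (\<Sum>j=h..<i. d j) - (real i - real h) * a i"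
    by simp
  have "{i+1..N} = {i+1..k} \<union> {k+1..N}" using i by auto
  then have "(\<Sum>j=i+1..N. max 0 (x - a j)) =
      (\<Sum>j=i+1..k. max 0 (x - a j)) + (\<Sum>j=k+1..N. max 0 (x - a j))"
    by (simp add: sum.union_disjoint)
  also have "(\<Sum>j=k+1..N. max 0 (x - a j)) = 0"
  proof (intro sum.neutral ballI)
    fix j assume j: "j \<in> {k+1..N}"
    then have "x \<le> a (k+1)" "a (k+1) \<le> a j" using k mono_onD[OF a, of "k+1" j] by auto
    then show "max 0 (x - a j) = 0" by simp
  qed
  also have "(\<Sum>j=i+1..k. max 0 (x - a j)) = (\<Sum>j=i+1..k. x - a j)"
  proof (intro sum.cong refl)
    fix j assume j: "j \<in> {i+1..k}"
    then have "a k \<le> x" "a j \<le> a k" using i k mono_onD[OF a, of j k] by auto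
    then show "max 0 (x - a j) = x - a j" by simp
  qed
  also have "\<dots> = (real k - real i) * x - (\<Sum>j=i+1..k. a j)"
    using i by (simp add: sum_subtractf)
  finally have a_sum: "(\<Sum>j=i+1..N. max 0 (x - a j)) = (real k - real i) * x - (\<Sum>j=i+1..k. a j)"
    by simp
  have "0 < \<beta> - \<alpha> * (real k - real i)" using i by (intro rate_at_pos) auto
  then have "(\<beta> - \<alpha> * (real k - real i)) * d_tilde \<alpha> \<beta> i k h d a =
      1 + (\<beta> - \<alpha> * (real i - real h)) * a i + \<alpha> * ((\<Sum>j=h..<i. d j) - (\<Sum>j=i+1..k. a j))"
    by (simp add: d_tilde_def)
  then show ?thesis
    unfolding served_def d_sum a_sum by (simp add: algebra_simps)
qed

section \<open>One round of the first algorithm\<close>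

text \<open>The invariant after \<open>n\<close> rounds. Its last conjunct is amortisation: every evaluation
  beyond the first one of a round increases \<open>k\<close>, which never exceeds \<open>N\<close>.\<close>

definition alg_inv :: "(nat \<Rightarrow> real) \<Rightarrow> nat \<Rightarrow> alg_state \<Rightarrow> bool" where
  "alg_inv a n s \<longleftrightarrow>
     (\<forall>j\<in>{1..n}. a j \<le> xvec s j \<and> served a (xvec s) j (xvec s j) = 1 \<and>
        j \<le> kvec s j \<and> kvec s j \<le> N \<and> a (kvec s j) \<le> xvec s j \<and>
        (kvec s j < N \<longrightarrow> xvec s j < a (kvec s j + 1))) \<and>
     mono_on {1..n} (xvec s) \<and> (\<forall>j. j \<notin> {1..n} \<longrightarrow> xvec s j = undefined) \<and>
     kvec s 0 = 1 \<and> (\<forall>j>n. kvec s j = j) \<and>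
     (n < N \<longrightarrow> 1 \<le> hvec s (n + 1) \<and> hvec s (n + 1) \<le> n + 1 \<and>
        (\<forall>j\<in>{1..n}. hvec s (n + 1) \<le> j \<longleftrightarrow> a (n + 1) \<le> xvec s j)) \<and>
     steps s + 1 \<le> n + kvec s n"

text \<open>The lower bound by \<open>a k\<close> persists: while the guard holds, the piece of
  \<open>k\<close> is at most 1 at \<open>a (k + 1)\<close>, where it agrees with the next piece. On
  exit the value lies within its own piece, where \<open>served\<close> really equals 1. The
  infinite entry at \<open>N + 1\<close> keeps \<open>k\<close> below \<open>N\<close> whenever the
  guard holds.\<close>

lemma alg1a_loop:
  assumes a: "mono_on {1..N} a" and i: "1 \<le> i" "i \<le> N" and h: "1 \<le> h" "h \<le> i"
    and hd: "\<And>j. j \<in> {1..<i} \<Longrightarrow> h \<le> j \<longleftrightarrow> a i \<le> d j"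
    and k0: "i \<le> k0" "k0 \<le> N" and init: "a k0 \<le> d_tilde \<alpha> \<beta> i k0 h d a"
  shows "\<exists>k. while_option
             (\<lambda>(k, v, c). ereal v \<ge> with_infinities N a (k + 1))
             (\<lambda>(k, v, c). (k + 1, d_tilde \<alpha> \<beta> i (k + 1) h d a, c + 1))
             (k0, d_tilde \<alpha> \<beta> i k0 h d a, c0) = Some (k, d_tilde \<alpha> \<beta> i k h d a, c0 + (k - k0))
           \<and> k0 \<le> k \<and> k \<le> N \<and> a k \<le> d_tilde \<alpha> \<beta> i k h d a
           \<and> (k < N \<longrightarrow> d_tilde \<alpha> \<beta> i k h d a < a (k + 1))"
proof -
  let ?b = "\<lambda>(k, v, c). ereal v \<ge> with_infinities N a (k + 1)"
  let ?c = "\<lambda>(k, v, c). (k + 1, d_tilde \<alpha> \<beta> i (k + 1) h d a, c + 1)"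
  let ?P = "\<lambda>(k, v, c). k0 \<le> k \<and> k \<le> N \<and> v = d_tilde \<alpha> \<beta> i k h d a \<and> a k \<le> v
      \<and> c = c0 + (k - k0)"
  let ?s = "(k0, d_tilde \<alpha> \<beta> i k0 h d a, c0)"
  have step: "?P (?c s) \<and> (\<lambda>(k, v, c). N - k) (?c s) < (\<lambda>(k, v, c). N - k) s"
    if "?P s" "?b s" for s :: "nat \<times> real \<times> nat"
  proof -
    obtain k v c where s: "s = (k, v, c)" by (cases s) auto
    have k: "k0 \<le> k" "k < N" and v: "v = d_tilde \<alpha> \<beta> i k h d a" "a (k + 1) \<le> v"
      and c: "c = c0 + (k - k0)"
      using that by (auto simp: s with_infinities_def split: if_splits)
    \<comment> \<open>The breakpoint \<open>a (k + 1)\<close> belongs to both closed pieces, so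
      \<open>served_affine\<close> applies with \<open>k\<close> and with
      \<open>k + 1\<close>.\<close>
    have "served a d i (a (k + 1)) =
        1 + (\<beta> - \<alpha> * (real k - real i)) * (a (k + 1) - d_tilde \<alpha> \<beta> i k h d a)"
      using k k0 i mono_onD[OF a, of k "k + 1"] by (intro served_affine[OF a h _ _ hd]) auto
    also have "\<dots> \<le> 1"
      using v k k0 i rate_at_pos[of "real k - real i"] by (simp add: mult_le_0_iff)
    finally have "served a d i (a (k + 1)) \<le> 1" .
    moreover have "served a d i (a (k + 1)) =
        1 + (\<beta> - \<alpha> * (real (k + 1) - real i)) * (a (k + 1) - d_tilde \<alpha> \<beta> i (k + 1) h d a)"
      using k k0 i mono_onD[OF a, of "k + 1" "k + 1 + 1"]
      by (intro served_affine[OF a h _ _ hd]) auto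
    moreover have "0 < \<beta> - \<alpha> * (real (k + 1) - real i)"
      using k i by (intro rate_at_pos) auto
    ultimately have "a (k + 1) \<le> d_tilde \<alpha> \<beta> i (k + 1) h d a"
      by (simp add: mult_le_0_iff)
    then show ?thesis using k c by (auto simp: s)
  qed
  have P0: "?P ?s" using k0 init by simp
  have "\<exists>t. while_option ?b ?c ?s = Some t"
    by (rule measure_while_option_Some[of ?P ?b ?c "\<lambda>(k, v, c). N - k" ?s, OF step P0])
  then obtain t where t: "while_option ?b ?c ?s = Some t" ..
  have "?P t"
    by (rule while_option_rule[of ?P ?b ?c, OF conjunct1[OF step] t P0])
  moreover have "\<not> ?b t" using while_option_stop[OF t] .
  ultimately show ?thesis using t
    by (cases t) (auto simp: with_infinities_def not_le split: if_splits)
qed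

lemma alg1a_body_inv:
  assumes a: "mono_on {1..N} a" and n: "n < N" and inv: "alg_inv a n s"
  shows "\<exists>s'. alg1a_body N \<alpha> \<beta> a (n + 1) s = Some s' \<and> alg_inv a (n + 1) s'"
proof -
  define i where "i = n + 1"
  define h where "h = hvec s i"
  define x where "x = xvec s"
  define k0 where "k0 = max i (kvec s n)"
  define dt where "dt = (\<lambda>k. d_tilde \<alpha> \<beta> i k h x a)"
  have i: "1 \<le> i" "i \<le> N" "i \<in> {1..N}" using n by (auto simp: i_def)
  have departed: "a j \<le> x j" "served a x j (x j) = 1" "j \<le> kvec s j" "kvec s j \<le> N"
      "a (kvec s j) \<le> x j" "kvec s j < N \<Longrightarrow> x j < a (kvec s j + 1)" if "j \<in> {1..n}" for j
    using inv that unfolding alg_inv_def x_def by blast+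
  have xmono: "mono_on {1..n} x" and xundef: "\<And>j. j \<notin> {1..n} \<Longrightarrow> x j = undefined"
    and k_zero: "kvec s 0 = 1" and k_id: "\<And>j. j > n \<Longrightarrow> kvec s j = j"
    and st: "steps s + 1 \<le> n + kvec s n"
    using inv unfolding alg_inv_def x_def by blast+
  have h: "1 \<le> h" "h \<le> i" and hd: "\<And>j. j \<in> {1..<i} \<Longrightarrow> h \<le> j \<longleftrightarrow> a i \<le> x j"
    using inv n unfolding alg_inv_def x_def h_def i_def by auto
  have kn: "kvec s n \<le> N" using departed(4)[of n] k_zero n by (cases n) auto
  have k0: "i \<le> k0" "k0 \<le> N" using kn i by (auto simp: k0_def)
  have pred: "served a x i (x n) \<le> 1" if "1 \<le> n"
    using served_Suc_le[OF a that n, of x] departed(1,2)[of n] that by (simp add: i_def)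
  have init: "a k0 \<le> dt k0"
  \<comment> \<open>If the previous \<open>k\<close> exceeds \<open>i\<close>, the search resumes in
    the piece containing \<open>x n\<close>, where user \<open>i\<close> has received at most 1;
    \<open>kvec s 0 = 1\<close> excludes the first round here. Otherwise it starts at
    \<open>a i\<close>, where the served amount is at most 0.\<close>
  proof (cases "i < kvec s n")
    case True
    then have n1: "1 \<le> n" using k_zero i by (cases n) auto
    then have nn: "n \<in> {1..n}" by simp
    have k: "k0 = kvec s n" using True by (simp add: k0_def)
    have "served a x i (x n) = 1 + (\<beta> - \<alpha> * (real k0 - real i)) * (x n - dt k0)"
      unfolding dt_def using departed(5,6)[OF nn] k k0
      by (intro served_affine[OF a h _ _ hd]) auto
    moreover have "0 < \<beta> - \<alpha> * (real k0 - real i)" using k0 i by (intro rate_at_pos) auto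
    ultimately have "x n \<le> dt k0" using pred[OF n1] by (simp add: mult_le_0_iff)
    then show ?thesis using departed(5)[OF nn] k by simp
  next
    case False
    then have k: "k0 = i" by (simp add: k0_def)
    have "served a x i (a i) = 1 + (\<beta> - \<alpha> * (real i - real i)) * (a i - dt i)"
      unfolding dt_def using i mono_onD[OF a, of i "i + 1"]
      by (intro served_affine[OF a h _ _ hd]) auto
    moreover have "served a x i (a i) \<le> 0" using served_at_arrival .
    moreover have "0 < \<beta>" using rate_at_pos[of 0] N_pos by simp
    ultimately have "\<beta> * (a i - dt i) \<le> 0" by simp
    then show ?thesis using k \<open>0 < \<beta>\<close> by (simp add: mult_le_0_iff)
  qed
  obtain k where loop: "while_option
             (\<lambda>(k, v, c). ereal v \<ge> with_infinities N a (k + 1))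
             (\<lambda>(k, v, c). (k + 1, dt (k + 1), c + 1))
             (k0, dt k0, steps s + 1) = Some (k, dt k, steps s + 1 + (k - k0))"
      and k: "k0 \<le> k" "k \<le> N" "a k \<le> dt k" "k < N \<Longrightarrow> dt k < a (k + 1)"
    using alg1a_loop[OF a i(1,2) h hd k0 init[unfolded dt_def], of "steps s + 1"]
    unfolding dt_def by blast
  define v where "v = dt k"
  have served_v: "served a x i v = 1"
  proof -
    have "served a x i v = 1 + (\<beta> - \<alpha> * (real k - real i)) * (v - dt k)"
      unfolding dt_def using k k0 v_def by (intro served_affine[OF a h _ _ hd]) auto
    then show ?thesis by (simp add: v_def)
  qed
  have av: "a i \<le> v"
    using served_at_arrival[of a x i] served_v served_less_iff[OF i(3), of a x v "a i"] by simp
  have xv: "x n \<le> v" if "1 \<le> n"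
    using pred[OF that] served_v served_less_iff[OF i(3), of a x v "x n"] by simp
  define kv where "kv = (kvec s)(i := k)"
  define H where "H = {h \<in> {1..i+1}. i + 1 \<le> kv h}"
  define s' where "s' = \<lparr> xvec = x(i := v), kvec = kv,
      hvec = (if i < N then (hvec s)(i + 1 := Min H) else hvec s), steps = steps s + 1 + (k - k0) \<rparr>"
  have body: "alg1a_body N \<alpha> \<beta> a i s = Some s'"
    using loop
    unfolding alg1a_body_def Let_def s'_def H_def kv_def v_def x_def h_def dt_def k0_def
    by (simp add: i_def)
  define y where "y = x(i := v)"
  have y_done: "a j \<le> y j \<and> served a y j (y j) = 1 \<and> j \<le> kv j \<and> kv j \<le> N \<and>
      a (kv j) \<le> y j \<and> (kv j < N \<longrightarrow> y j < a (kv j + 1))" if j: "j \<in> {1..i}" for j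
  proof -
    \<comment> \<open>Overwriting entry \<open>i\<close> does not affect \<open>served\<close> for
      \<open>j \<le> i\<close>, since only entries before \<open>j\<close> are read.\<close>
    have "served a y j z = served a x j z" for z
      using j by (intro served_cong) (auto simp: y_def)
    then show ?thesis
      using j departed[of j] av served_v k k0 by (cases "j = i") (auto simp: y_def kv_def i_def v_def)
  qed
  have ymono: "mono_on {1..i} y"
  proof (intro mono_onI)
    fix p q assume pq: "p \<in> {1..i}" "q \<in> {1..i}" "p \<le> q"
    have "x p \<le> v" if "p \<le> n"
      using mono_onD[OF xmono, of p n] xv that pq by fastforce
    then show "y p \<le> y q"
      using pq mono_onD[OF xmono, of p q] by (auto simp: y_def i_def le_Suc_eq)
  qed
  have H: "Min H \<in> H"
  proof (rule Min_in)
    show "finite H" by (simp add: H_def)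
    \<comment> \<open>Index \<open>i + 1\<close> is a member because its \<open>k\<close> still has
      the initial value.\<close>
    show "H \<noteq> {}" using k_id[of "i + 1"] by (auto simp: H_def kv_def i_def intro!: exI[of _ "i + 1"])
  qed
  \<comment> \<open>\<open>kv j\<close> is the last user arriving no later than \<open>y j\<close>,
    so it tells whether \<open>j\<close> is still present at the next arrival.\<close>
  have k_iff: "i + 1 \<le> kv j \<longleftrightarrow> a (i + 1) \<le> y j" if j: "j \<in> {1..i}" and "i < N" for j
  proof
    assume "i + 1 \<le> kv j"
    then show "a (i + 1) \<le> y j"
      using y_done[OF j] mono_onD[OF a, of "i + 1" "kv j"] by force
  next
    assume *: "a (i + 1) \<le> y j"
    show "i + 1 \<le> kv j"
    proof (rule ccontr)
      assume "\<not> i + 1 \<le> kv j"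
      then show False
        using * y_done[OF j] \<open>i < N\<close> mono_onD[OF a, of "kv j + 1" "i + 1"] by force
    qed
  qed
  \<comment> \<open>Departures are sorted, so the users still present form a possibly empty final
    segment of \<open>{1..i}\<close>, which one index describes.\<close>
  have h_iff: "Min H \<le> j \<longleftrightarrow> a (i + 1) \<le> y j" if j: "j \<in> {1..i}" and iN: "i < N" for j
  proof
    assume le: "Min H \<le> j"
    then have "Min H \<in> {1..i}" "i + 1 \<le> kv (Min H)" using H j by (auto simp: H_def)
    then show "a (i + 1) \<le> y j"
      using k_iff iN mono_onD[OF ymono, of "Min H" j] le j by force
  next
    assume "a (i + 1) \<le> y j"
    then have "j \<in> H" using k_iff[OF j iN] j by (simp add: H_def)
    then show "Min H \<le> j" by (intro Min_le) (auto simp: H_def)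
  qed
  \<comment> \<open>The first evaluation is paid by the new round, the other \<open>k - k0\<close>
    by the growth of \<open>k\<close>, because \<open>k0\<close> is at least
    \<open>kvec s n\<close>.\<close>
  have "steps s + 1 + (k - k0) + 1 \<le> i + kv i"
    using st k k0 by (auto simp: kv_def i_def k0_def)
  moreover have "1 \<le> Min H" "Min H \<le> i + 1" using H by (auto simp: H_def)
  moreover have "kv 0 = 1" "\<And>j. j > i \<Longrightarrow> kv j = j" using k_zero k_id by (auto simp: kv_def i_def)
  moreover have "\<And>j. j \<notin> {1..i} \<Longrightarrow> y j = undefined" using xundef by (auto simp: y_def i_def)
  ultimately have "alg_inv a i s'"
    using y_done ymono h_iff unfolding alg_inv_def s'_def y_def[symmetric] by simp
  then show ?thesis using body unfolding i_def by blast
qed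

section \<open>Running the algorithms round by round\<close>

definition alg1a_upto :: "(nat \<Rightarrow> real) \<Rightarrow> nat \<Rightarrow> alg_state option" where
  "alg1a_upto a n = fold (\<lambda>i s. Option.bind s (alg1a_body N \<alpha> \<beta> a i)) [1..<n+1]
       (Some \<lparr> xvec = (\<lambda>_. undefined), kvec = (\<lambda>i. i)(0 := 1), hvec = (\<lambda>i. i), steps = 0 \<rparr>)"

definition alg1b_upto :: "(nat \<Rightarrow> real) \<Rightarrow> nat \<Rightarrow> alg_state option" where
  "alg1b_upto d n =
     fold (\<lambda>i s. Option.bind s (alg1b_body N \<alpha> \<beta> d i)) (map (\<lambda>i. N + 1 - i) [1..<n+1])
       (Some \<lparr> xvec = (\<lambda>_. undefined), kvec = (\<lambda>i. i), hvec = (\<lambda>i. i)(N + 1 := N), steps = 0 \<rparr>)"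

lemma alg1a_upto_Suc:
  "alg1a_upto a (Suc n) = Option.bind (alg1a_upto a n) (alg1a_body N \<alpha> \<beta> a (n + 1))"
  by (simp add: alg1a_upto_def)

lemma alg1b_upto_Suc:
  "alg1b_upto d (Suc n) = Option.bind (alg1b_upto d n) (alg1b_body N \<alpha> \<beta> d (N + 1 - (n + 1)))"
  by (simp add: alg1b_upto_def)

lemma alg1a_eq: "alg1a N \<alpha> \<beta> a = alg1a_upto a N"
  by (simp add: alg1a_def alg1a_upto_def)

lemma alg1b_eq: "alg1b N \<alpha> \<beta> d = alg1b_upto d N"
proof -
  have "rev [1..<N+1] = map (\<lambda>i. N + 1 - i) [1..<N+1]"
    by (rule nth_equalityI) (simp_all add: rev_nth del: upt_Suc)
  then show ?thesis by (simp only: alg1b_def alg1b_upto_def)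
qed

lemma alg1a_upto_inv:
  assumes a: "mono_on {1..N} a" and "n \<le> N"
  shows "\<exists>s. alg1a_upto a n = Some s \<and> alg_inv a n s"
  using \<open>n \<le> N\<close>
proof (induction n)
  case 0
  \<comment> \<open>With \<open>kvec s 0 = 1\<close> the evaluation budget starts as an
    equality.\<close>
  then show ?case
    by (auto simp: alg1a_upto_def alg_inv_def mono_on_def)
next
  case (Suc n)
  then show ?case using alg1a_body_inv[OF a] by (fastforce simp: alg1a_upto_Suc)
qed

lemma alg_inv_N:
  assumes a: "mono_on {1..N} a" and inv: "alg_inv a N s"
  shows "xvec s \<in> vecs N" "dynamics N \<alpha> \<beta> a (xvec s)" "steps s \<le> 2 * N"
proof -
  show "xvec s \<in> vecs N" using inv by (auto simp: alg_inv_def PiE_def extensional_def)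
  show "dynamics N \<alpha> \<beta> a (xvec s)"
    using inv dynamics_iff_served[OF a] unfolding alg_inv_def by blast
  have "N \<in> {1..N}" using N_pos by simp
  then have "kvec s N \<le> N" using inv unfolding alg_inv_def by blast
  moreover have "steps s + 1 \<le> N + kvec s N" using inv unfolding alg_inv_def by blast
  ultimately show "steps s \<le> 2 * N" by linarith
qed

section \<open>Simulation of the second algorithm by the reflected first one\<close>

text \<open>The reflection of the arrays \<open>k\<close> and \<open>h\<close> exchanges them. Of the array that is
  not searched in the next round, only the entry read there is related.\<close>

definition mirrored :: "nat \<Rightarrow> alg_state \<Rightarrow> alg_state \<Rightarrow> bool" where
  "mirrored n s t \<longleftrightarrow>
     (\<forall>j\<in>{1..n}. xvec t (N + 1 - j) = - xvec s j) \<and>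
     (\<forall>j. j \<notin> {N + 1 - n..N} \<longrightarrow> xvec t j = undefined) \<and>
     (\<forall>j\<le>N. hvec t (N + 1 - j) = N + 1 - kvec s j) \<and>
     (n < N \<longrightarrow> kvec t (N - n) = N + 1 - hvec s (n + 1)) \<and>
     steps t = steps s"

text \<open>Reflection negates times and exchanges the sum over earlier departures with the sum over
  later arrivals, so the two index bounds trade places.\<close>

lemma a_tilde_reflect:
  assumes i: "1 \<le> h" "h \<le> i" "i \<le> k" "k \<le> N"
    and x: "\<And>j. j \<in> {h..<i} \<Longrightarrow> x (N + 1 - j) = - y j"
  shows "a_tilde \<alpha> \<beta> (N + 1 - i) (N + 1 - h) (N + 1 - k) x d
    = - d_tilde \<alpha> \<beta> i k h y (reflect N d)"
proof -
  have "{N + 1 - k..<N + 1 - i} = {N + 1 - k..N + 1 - (i + 1)}" using i by auto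
  then have "(\<Sum>j=N + 1 - k..<N + 1 - i. d j) = (\<Sum>j=i+1..k. d (N + 1 - j))"
    using sum_reflect_interval[of k N "i+1" d] i by simp
  also have "\<dots> = - (\<Sum>j=i+1..k. reflect N d j)"
    using i by (simp add: reflect_apply sum_negf[symmetric])
  finally have d_sum: "(\<Sum>j=N + 1 - k..<N + 1 - i. d j) = - (\<Sum>j=i+1..k. reflect N d j)" .
  have "(\<Sum>j=N + 1 - i + 1..N + 1 - h. x j) = (\<Sum>j=h..<i. x (N + 1 - j))"
    by (rule sum.reindex_bij_witness[of _ "\<lambda>j. N + 1 - j" "\<lambda>j. N + 1 - j"]) (use i in auto)
  also have "\<dots> = - (\<Sum>j=h..<i. y j)"
    using x by (simp add: sum_negf[symmetric])
  finally have x_sum: "(\<Sum>j=N + 1 - i + 1..N + 1 - h. x j) = - (\<Sum>j=h..<i. y j)" .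
  have di: "d (N + 1 - i) = - reflect N d i" using i by (simp add: reflect_apply)
  have r: "real (N + 1 - h) - real (N + 1 - i) = real i - real h"
    "real (N + 1 - i) - real (N + 1 - k) = real k - real i"
    using i by auto
  show ?thesis
    unfolding a_tilde_def d_tilde_def d_sum x_sum di r
    by (simp add: minus_divide_left algebra_simps del: minus_divide_left[symmetric])
qed

text \<open>Turns the minimum updating \<open>hvec\<close> in one algorithm into the maximum
  updating \<open>kvec\<close> in the other; subtraction from \<open>M\<close> stays antitone where
  it truncates at 0.\<close>

lemma Max_reflect:
  fixes S :: "nat set"
  assumes "finite S" "S \<noteq> {}"
  shows "Max ((\<lambda>j. M - j) ` S) = M - Min S"
  by (rule Max_eqI) (use assms in \<open>auto intro: diff_le_mono2\<close>)

text \<open>\<open>f\<close> intertwines guards and bodies of the two inner loops, so they stop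
  together, with opposite values and equal counts.\<close>

lemma alg1b_body_mirrored:
  assumes a: "mono_on {1..N} (reflect N d)" and n: "n < N" and inv: "alg_inv (reflect N d) n s"
    and mir: "mirrored n s t" and s': "alg1a_body N \<alpha> \<beta> (reflect N d) (n + 1) s = Some s'"
  shows "\<exists>t'. alg1b_body N \<alpha> \<beta> d (N + 1 - (n + 1)) t = Some t' \<and> mirrored (n + 1) s' t'"
proof -
  define i where "i = n + 1"
  define i' where "i' = N + 1 - i"
  define h where "h = hvec s i"
  define x where "x = xvec s"
  define y where "y = xvec t"
  define k0 where "k0 = max i (kvec s n)"
  define a where "a = reflect N d"
  define dt where "dt = (\<lambda>k. d_tilde \<alpha> \<beta> i k h x a)"
  define aq where "aq = (\<lambda>h'. a_tilde \<alpha> \<beta> i' (kvec t i') h' y d)"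
  define f :: "nat \<times> real \<times> nat \<Rightarrow> nat \<times> real \<times> nat"
    where "f = (\<lambda>(k, v, c). (N + 1 - k, - v, c))"
  define b :: "nat \<times> real \<times> nat \<Rightarrow> bool"
    where "b = (\<lambda>(k, v, c). ereal v \<ge> with_infinities N a (k + 1))"
  define c :: "nat \<times> real \<times> nat \<Rightarrow> nat \<times> real \<times> nat"
    where "c = (\<lambda>(k, v, c). (k + 1, dt (k + 1), c + 1))"
  define b' :: "nat \<times> real \<times> nat \<Rightarrow> bool"
    where "b' = (\<lambda>(h, v, c). ereal v \<le> with_infinities N d (h - 1))"
  define c' :: "nat \<times> real \<times> nat \<Rightarrow> nat \<times> real \<times> nat"
    where "c' = (\<lambda>(h, v, c). (h - 1, aq (h - 1), c + 1))"
  have i: "1 \<le> i" "i \<le> N" "i \<in> {1..N}" using n by (auto simp: i_def)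
  have xy: "y (N + 1 - j) = - x j" if "j \<in> {1..n}" for j
    using mir that by (simp add: mirrored_def x_def y_def)
  have y_undef: "y j = undefined" if "j \<notin> {N + 1 - n..N}" for j
    using mir that by (simp add: mirrored_def y_def)
  have kh: "hvec t (N + 1 - j) = N + 1 - kvec s j" if "j \<le> N" for j
    using mir that by (simp add: mirrored_def)
  have h: "1 \<le> h" "h \<le> i" using inv n unfolding alg_inv_def h_def i_def by auto
  have kt: "kvec t i' = N + 1 - h" using mir n by (simp add: mirrored_def i'_def i_def h_def)
  have kn: "kvec s n \<le> N"
    using inv n unfolding alg_inv_def by (cases n) auto
  have k0: "i \<le> k0" "k0 \<le> N" using kn i by (auto simp: k0_def)
  \<comment> \<open>For \<open>n = 0\<close> this matches the conventional values:
    \<open>hvec t (N + 1)\<close> is \<open>N\<close> and \<open>kvec s 0\<close> is 1.\<close>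
  have h0: "min i' (hvec t (i' + 1)) = N + 1 - k0"
    using kh[of n] n i by (auto simp: k0_def i'_def i_def Suc_diff_le)
  have aq: "aq (N + 1 - k) = - dt k" if "i \<le> k" "k \<le> N" for k
    unfolding aq_def dt_def kt unfolding i'_def a_def
    by (rule a_tilde_reflect) (use that h xy in \<open>auto simp: i_def\<close>)
  have init: "f (k0, dt k0, steps s + 1) = (N + 1 - k0, aq (N + 1 - k0), steps t + 1)"
    using aq[OF k0] mir by (simp add: f_def mirrored_def)
  have cond: "b p = b' (f p)" for p
  proof -
    obtain k v m where p: "p = (k, v, m)" by (cases p) auto
    show ?thesis
    proof (cases "k + 1 \<le> N")
      case True
      then have "a (k + 1) = - d (N - k)" unfolding a_def by (subst reflect_apply) auto
      then show ?thesis using True by (auto simp: p b_def b'_def f_def with_infinities_def)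
    next
      \<comment> \<open>Past user \<open>N\<close> the reflected index truncates to 0, so infinity
        on one side meets minus infinity on the other and both guards fail.\<close>
      case False
      then show ?thesis by (auto simp: p b_def b'_def f_def with_infinities_def)
    qed
  qed
  \<comment> \<open>The fact \<open>aq\<close> is available for \<open>k\<close> between
    \<open>i\<close> and \<open>N\<close>; \<open>Q\<close> gives the lower bound and the guard the
    upper one.\<close>
  define Q :: "nat \<times> real \<times> nat \<Rightarrow> bool" where "Q = (\<lambda>(k, v, m). i \<le> k)"
  have comm: "f (c p) = c' (f p)" if "Q p" "b p" for p
  proof -
    obtain k v m where p: "p = (k, v, m)" by (cases p) auto
    have "i \<le> k" "k + 1 \<le> N"
      using that by (auto simp: p b_def Q_def with_infinities_def split: if_splits)
    then show ?thesis using aq[of "k + 1"] by (simp add: p c_def c'_def f_def)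
  qed
  have "map_option f (while_option b c (k0, dt k0, steps s + 1)) =
      while_option b' c' (f (k0, dt k0, steps s + 1))"
  proof (rule while_option_commute_invariant[where P = Q])
    show "Q (k0, dt k0, steps s + 1)" using k0 by (simp add: Q_def)
    show "\<And>p. Q p \<Longrightarrow> b p \<Longrightarrow> Q (c p)" by (auto simp: Q_def c_def)
  qed (use cond comm in auto)
  moreover obtain k v m where loop: "while_option b c (k0, dt k0, steps s + 1) = Some (k, v, m)"
    and s'_eq: "s' = \<lparr> xvec = x(i := v), kvec = (kvec s)(i := k),
      hvec = (if i < N then (hvec s)(i + 1 := Min {h \<in> {1..i+1}. i + 1 \<le> ((kvec s)(i := k)) h})
              else hvec s), steps = m \<rparr>"
    using s' unfolding alg1a_body_def Let_def b_def c_def dt_def k0_def x_def h_def i_def a_def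
    by (auto simp: map_option_case split: option.splits)
  ultimately have loop': "while_option b' c' (N + 1 - k0, aq (N + 1 - k0), steps t + 1)
      = Some (N + 1 - k, - v, m)"
    unfolding init[symmetric] by (simp add: f_def)
  define kv where "kv = (kvec s)(i := k)"
  define hv where "hv = (hvec t)(i' := N + 1 - k)"
  define t' where "t' = \<lparr> xvec = y(i' := - v),
      kvec = (if i' > 1 then (kvec t)(i' - 1 := Max {k \<in> {i'-1..N}. hv k \<le> i' - 1}) else kvec t),
      hvec = hv, steps = m \<rparr>"
  have body: "alg1b_body N \<alpha> \<beta> d i' t = Some t'"
    using loop' h0 unfolding alg1b_body_def Let_def b'_def c'_def aq_def y_def t'_def hv_def
    by simp
  have kh': "hv (N + 1 - j) = N + 1 - kv j" if "j \<le> N" for j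
    using kh[OF that] that i by (auto simp: hv_def kv_def i'_def)
  \<comment> \<open>A user \<open>j\<close> with \<open>kv j\<close> at least \<open>i + 1\<close>
    reflects to an index whose \<open>hv\<close> is at most \<open>i' - 1\<close>, so the sets
    defining the two updates are mirror images.\<close>
  have M: "Max {k \<in> {i'-1..N}. hv k \<le> i' - 1} = N + 1 - Min {h \<in> {1..i+1}. i + 1 \<le> kv h}"
    if iN: "i < N"
  proof -
    let ?S = "{h \<in> {1..i+1}. i + 1 \<le> kv h}"
    have iff: "hv (N + 1 - j) \<le> i' - 1 \<longleftrightarrow> i + 1 \<le> kv j" if "j \<le> N" for j
      using kh'[OF that] iN by (auto simp: i'_def)
    have "{k \<in> {i'-1..N}. hv k \<le> i' - 1} = (\<lambda>j. N + 1 - j) ` ?S"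
    proof (intro equalityI subsetI)
      fix q assume q: "q \<in> {k \<in> {i'-1..N}. hv k \<le> i' - 1}"
      then have "N + 1 - (N + 1 - q) = q" "N + 1 - q \<in> {1..i+1}" "N + 1 - q \<le> N"
        using iN by (auto simp: i'_def)
      then show "q \<in> (\<lambda>j. N + 1 - j) ` ?S"
        using q iff[of "N + 1 - q"] by (intro image_eqI[of _ _ "N + 1 - q"]) auto
    next
      fix q assume "q \<in> (\<lambda>j. N + 1 - j) ` ?S"
      then obtain j where "q = N + 1 - j" "j \<in> ?S" by blast
      then show "q \<in> {k \<in> {i'-1..N}. hv k \<le> i' - 1}"
        using iff[of j] iN by (auto simp: i'_def)
    qed
    moreover have "i + 1 \<in> ?S"
      using inv iN by (auto simp: kv_def alg_inv_def i_def)
    ultimately show ?thesis using Max_reflect[of ?S "N + 1"] by force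
  qed
  have "mirrored i s' t'"
    unfolding mirrored_def
  proof (intro conjI ballI allI impI)
    show "xvec t' (N + 1 - j) = - xvec s' j" if "j \<in> {1..i}" for j
      using that xy[of j] i by (auto simp: t'_def s'_eq i'_def i_def)
    show "xvec t' j = undefined" if "j \<notin> {N + 1 - i..N}" for j
      using that y_undef[of j] i by (auto simp: t'_def i'_def i_def)
    show "hvec t' (N + 1 - j) = N + 1 - kvec s' j" if "j \<le> N" for j
      using kh'[OF that] by (simp add: t'_def s'_eq kv_def)
    show "kvec t' (N - i) = N + 1 - hvec s' (i + 1)" if "i < N"
      using M[OF that] that by (auto simp: t'_def s'_eq i'_def kv_def)
    show "steps t' = steps s'" by (simp add: t'_def s'_eq)
  qed
  then show ?thesis using body unfolding i'_def i_def by blast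
qed

lemma alg1b_upto_mirrored:
  assumes a: "mono_on {1..N} (reflect N d)" and "n \<le> N"
  shows "\<exists>s t. alg1a_upto (reflect N d) n = Some s \<and> alg_inv (reflect N d) n s \<and>
    alg1b_upto d n = Some t \<and> mirrored n s t"
  using \<open>n \<le> N\<close>
proof (induction n)
  case 0
  let ?s = "\<lparr> xvec = (\<lambda>_. undefined), kvec = (\<lambda>i. i)(0 := 1), hvec = (\<lambda>i. i), steps = 0 \<rparr>"
  let ?t = "\<lparr> xvec = (\<lambda>_. undefined), kvec = (\<lambda>i. i), hvec = (\<lambda>i. i)(N + 1 := N), steps = 0 \<rparr>"
  have "mirrored 0 ?s ?t" by (auto simp: mirrored_def)
  then show ?case
    using alg1a_upto_inv[OF a, of 0] by (auto simp: alg1a_upto_def alg1b_upto_def)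
next
  case (Suc n)
  then obtain s t where st: "alg1a_upto (reflect N d) n = Some s" "alg_inv (reflect N d) n s"
    "alg1b_upto d n = Some t" "mirrored n s t" by auto
  obtain s' where s': "alg1a_body N \<alpha> \<beta> (reflect N d) (n + 1) s = Some s'"
    "alg_inv (reflect N d) (n + 1) s'"
    using alg1a_body_inv[OF a _ st(2)] Suc.prems by auto
  obtain t' where "alg1b_body N \<alpha> \<beta> d (N + 1 - (n + 1)) t = Some t'" "mirrored (n + 1) s' t'"
    using alg1b_body_mirrored[OF a _ st(2,4) s'(1)] Suc.prems by auto
  then show ?case using st s' by (simp add: alg1a_upto_Suc alg1b_upto_Suc)
qed

section \<open>Correctness of both algorithms and the step bound\<close>

lemma alg1a_correct:
  assumes "mono_on {1..N} a"
  shows "\<exists>s. alg1a N \<alpha> \<beta> a = Some s \<and> xvec s \<in> vecs N \<and>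
    dynamics N \<alpha> \<beta> a (xvec s) \<and> steps s \<le> 2 * N"
  using alg1a_upto_inv[OF assms, of N] alg_inv_N[OF assms] by (auto simp: alg1a_eq)

text \<open>The first algorithm solves the dynamics for the arrivals \<open>reflect N d\<close>;
  reflecting that solution back restores \<open>d\<close> as the departure vector.\<close>

lemma alg1b_correct:
  assumes d: "d \<in> vecs N" "mono_on {1..N} d"
  shows "\<exists>t. alg1b N \<alpha> \<beta> d = Some t \<and> xvec t \<in> vecs N \<and>
    dynamics N \<alpha> \<beta> (xvec t) d \<and> steps t \<le> 2 * N"
proof -
  note a = mono_on_reflect[OF d(2)]
  obtain s t where inv: "alg_inv (reflect N d) N s" and t: "alg1b N \<alpha> \<beta> d = Some t"
    and mir: "mirrored N s t"
    using alg1b_upto_mirrored[OF a, of N] by (auto simp: alg1b_eq)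
  have xt: "xvec t = reflect N (xvec s)"
  proof
    fix j
    show "xvec t j = reflect N (xvec s) j"
    proof (cases "j \<in> {1..N}")
      case True
      then have "N + 1 - j \<in> {1..N}" "N + 1 - (N + 1 - j) = j" by auto
      then show ?thesis using mir True unfolding mirrored_def by (metis reflect_apply)
    next
      case False
      then show ?thesis using mir by (auto simp: mirrored_def reflect_def)
    qed
  qed
  have "dynamics N \<alpha> \<beta> (xvec t) d"
    using dynamics_reflect[OF alg_inv_N(2)[OF a inv]] unfolding xt reflect_reflect[OF d(1)] .
  moreover have "steps t \<le> 2 * N" using mir alg_inv_N(3)[OF a inv] by (simp add: mirrored_def)
  moreover have "xvec t \<in> vecs N" unfolding xt by (rule reflect_in_vecs)
  ultimately show ?thesis using t by blast
qed

text \<open>Reflection yields two departure vectors for the arrivals \<open>reflect N d\<close>, to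
  which \<open>dynamics_unique\<close> applies; \<open>reflect\<close> is injective on
  \<open>vecs N\<close>.\<close>

lemma dynamics_unique_arrivals:
  assumes d: "mono_on {1..N} d" and a: "a \<in> vecs N" "dynamics N \<alpha> \<beta> a d"
    and a': "a' \<in> vecs N" "dynamics N \<alpha> \<beta> a' d"
  shows "a = a'"
proof -
  have "reflect N a = reflect N a'"
    using dynamics_unique[OF mono_on_reflect[OF d]] dynamics_reflect a(2) a'(2) reflect_in_vecs
    by metis
  then show ?thesis using a(1) a'(1) reflect_reflect by metis
qed

end

theorem proposition3p2:
  fixes N :: nat and \<alpha> \<beta> :: real
  assumes "N \<ge> 1" and "\<alpha> > 0" and "\<beta> > 0" and "real N < \<beta> / \<alpha> + 1"
  shows
    "(\<forall>a\<in>vecs N. mono_on {1..N} a \<longrightarrow>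
        (\<exists>s. alg1a N \<alpha> \<beta> a = Some s \<and>
             xvec s \<in> vecs N \<and> dynamics N \<alpha> \<beta> a (xvec s) \<and>
             (\<forall>d\<in>vecs N. dynamics N \<alpha> \<beta> a d \<longrightarrow> d = xvec s))) \<and>
     (\<forall>d\<in>vecs N. mono_on {1..N} d \<longrightarrow>
        (\<exists>s. alg1b N \<alpha> \<beta> d = Some s \<and>
             xvec s \<in> vecs N \<and> dynamics N \<alpha> \<beta> (xvec s) d \<and>
             (\<forall>a\<in>vecs N. dynamics N \<alpha> \<beta> a d \<longrightarrow> a = xvec s))) \<and>
     (\<forall>a\<in>vecs N. mono_on {1..N} a \<longrightarrow>
        (\<exists>s. alg1a N \<alpha> \<beta> a = Some s \<and> steps s \<le> 2 * N)) \<and>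
     (\<forall>d\<in>vecs N. mono_on {1..N} d \<longrightarrow>
        (\<exists>s. alg1b N \<alpha> \<beta> d = Some s \<and> steps s \<le> 2 * N))"
proof -
  have "\<alpha> * (real N - 1) < \<beta>"
    using assms by (simp add: field_simps)
  then interpret queue N \<alpha> \<beta>
    using assms by unfold_locales auto
  show ?thesis
  proof (intro conjI ballI impI)
    fix a assume a: "a \<in> vecs N" "mono_on {1..N} a"
    obtain s where s: "alg1a N \<alpha> \<beta> a = Some s" "xvec s \<in> vecs N"
      "dynamics N \<alpha> \<beta> a (xvec s)" "steps s \<le> 2 * N"
      using alg1a_correct[OF a(2)] by blast
    show "\<exists>s. alg1a N \<alpha> \<beta> a = Some s \<and> steps s \<le> 2 * N"
      using s by blast
    show "\<exists>s. alg1a N \<alpha> \<beta> a = Some s \<and> xvec s \<in> vecs N \<and> dynamics N \<alpha> \<beta> a (xvec s) \<and>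
             (\<forall>d\<in>vecs N. dynamics N \<alpha> \<beta> a d \<longrightarrow> d = xvec s)"
      using s dynamics_unique[OF a(2)] by blast
  next
    fix d assume d: "d \<in> vecs N" "mono_on {1..N} d"
    obtain s where s: "alg1b N \<alpha> \<beta> d = Some s" "xvec s \<in> vecs N"
      "dynamics N \<alpha> \<beta> (xvec s) d" "steps s \<le> 2 * N"
      using alg1b_correct[OF d] by blast
    show "\<exists>s. alg1b N \<alpha> \<beta> d = Some s \<and> steps s \<le> 2 * N"
      using s by blast
    show "\<exists>s. alg1b N \<alpha> \<beta> d = Some s \<and> xvec s \<in> vecs N \<and> dynamics N \<alpha> \<beta> (xvec s) d \<and>
             (\<forall>a\<in>vecs N. dynamics N \<alpha> \<beta> a d \<longrightarrow> a = xvec s)"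
      using s dynamics_unique_arrivals[OF d(2)] by blast
  qed
qed

end
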